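(* Let $p$ be a positive integer. Then the following statements hold. (i) If $p$ is odd then there exists a positive integer $K_p$ such that for all integers $k \ge K_p$, $$\mathcal{C}_{\mathrm{exp}}(k, p) = \mathcal{C}_{\mathrm{exp}}(\infty, p).$$ (ii) If $p$ is even then there exists a positive integer $k_p$ such that for all integers $k > k_p$, $$\frac{1}{k-1} \le \mathcal{C}_{\mathrm{exp}}(\infty, p-1) - \mathcal{C}_{\mathrm{exp}}(k, p) \le \frac{1}{k-k_p}.$$
   Context: A linear multistep method (LM method) with $k$ steps computes $u_n = \sum_{j=1}^{k} \alpha_j u_{n-j} + h \sum_{j=0}^k \beta_j f(u_{n-j})$ and is identified with its real coefficients $(\alpha_j)_{j=1}^k$, $(\beta_j)_{j=0}^k$ (no requirement that $\alpha_k$ or $\beta_k$ be non-zero). It is explicit if $\beta_0=0$. With the convention $0^0=1$, it has order $p$ if $\sum_{j=1}^{k}\alpha_j=1$ and $\sum_{j=1}^{k}(j^m\alpha_j - m j^{m-1}\beta_j) - m\,0^{m-1}\beta_0=0$ for all $1\le m\le p$. The SSP coefficient of a method is $\mathcal{C}=\min\{\alpha_j/\beta_j : 1\le j\le k,\ \beta_j\ne 0\}$ (with $\min\emptyset=+\infty$) if $\alpha_j\ge 0$ for $1\le j\le k$ and $\beta_j\ge 0$ for $0\le j\le k$, and $\mathcal{C}=0$ otherwise. $\mathcal{C}_{\mathrm{exp}}(k,p)$ is the supremum of $\mathcal{C}$ over all explicit $k$-step LM methods of order $p$, taken to be $0$ if there are no such methods. It is non-decreasing in $k$ and bounded, and $\mathcal{C}_{\mathrm{exp}}(\infty,p)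 := \lim_{k\to\infty}\mathcal{C}_{\mathrm{exp}}(k,p)$. *)

theory Defs
  imports Complex_Main "HOL-Library.Extended_Real"
begin

text \<open>
  A \<open>k\<close>-step linear multistep method
  \<open>u_n = (\<Sum>j=1..k. \<alpha> j * u_(n-j)) + h * (\<Sum>j=0..k. \<beta> j * f (u_(n-j)))\<close>
  is given by its coefficients \<open>\<alpha>, \<beta> :: nat \<Rightarrow> real\<close>. Only \<open>\<alpha> 1, \<dots>, \<alpha> k\<close> and
  \<open>\<beta> 0, \<dots>, \<beta> k\<close> matter: no definition below looks at any other value.
\<close>

definition lm_explicit :: "(nat \<Rightarrow> real) \<Rightarrow> bool" where
  "lm_explicit \<beta> \<longleftrightarrow> \<beta> 0 = 0"

text \<open>
  Having order \<open>p\<close> means satisfying the order conditions up to \<open>p\<close>, so it does not exclude a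
  higher order. In HOL \<open>0 ^ 0 = 1\<close>, as required for \<open>m = 1\<close>.
\<close>

definition lm_order :: "nat \<Rightarrow> (nat \<Rightarrow> real) \<Rightarrow> (nat \<Rightarrow> real) \<Rightarrow> nat \<Rightarrow> bool" where
  "lm_order k \<alpha> \<beta> p \<longleftrightarrow>
     (\<Sum>j=1..k. \<alpha> j) = 1 \<and>
     (\<forall>m\<in>{1..p}.
        (\<Sum>j=1..k. real j ^ m * \<alpha> j - real m * real j ^ (m - 1) * \<beta> j)
          - real m * 0 ^ (m - 1) * \<beta> 0 = 0)"

text \<open>
  The infimum is over a finite set, hence a minimum when the set is nonempty; over the empty set
  it is \<open>\<infinity>\<close> in \<^typ>\<open>ereal\<close>.
\<close>

definition ssp_coeff :: "nat \<Rightarrow> (nat \<Rightarrow> real) \<Rightarrow> (nat \<Rightarrow> real) \<Rightarrow> ereal" where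
  "ssp_coeff k \<alpha> \<beta> =
     (if (\<forall>j\<in>{1..k}. \<alpha> j \<ge> 0) \<and> (\<forall>j\<in>{0..k}. \<beta> j \<ge> 0)
      then (INF j\<in>{j\<in>{1..k}. \<beta> j \<noteq> 0}. ereal (\<alpha> j / \<beta> j))
      else 0)"

text \<open>The case distinction is needed because the supremum of the empty set is \<open>-\<infinity>\<close>.\<close>

definition C_exp :: "nat \<Rightarrow> nat \<Rightarrow> ereal" where
  "C_exp k p =
     (let S = {ssp_coeff k \<alpha> \<beta> | \<alpha> \<beta>. lm_explicit \<beta> \<and> lm_order k \<alpha> \<beta> p}
      in if S = {} then 0 else Sup S)"

definition C_exp_inf :: "nat \<Rightarrow> ereal" where
  "C_exp_inf p = lim (\<lambda>k. C_exp k p)"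

lemma ssp_coeff_nonneg: "0 \<le> ssp_coeff k \<alpha> \<beta>"
  unfolding ssp_coeff_def by (auto intro!: INF_greatest)

lemma C_exp_nonneg: "0 \<le> C_exp k p"
  unfolding C_exp_def Let_def by (auto intro: Sup_upper2 ssp_coeff_nonneg)

lemma ssp_coeff_le_1:
  assumes "p \<ge> 1" "lm_explicit \<beta>" "lm_order k \<alpha> \<beta> p"
  shows "ssp_coeff k \<alpha> \<beta> \<le> 1"
proof (cases "(\<forall>j\<in>{1..k}. \<alpha> j \<ge> 0) \<and> (\<forall>j\<in>{0..k}. \<beta> j \<ge> 0)")
  case True
  have s1: "(\<Sum>j=1..k. \<alpha> j) = 1" using assms unfolding lm_order_def by simp
  have "(\<Sum>j=1..k. real j * \<alpha> j - \<beta> j) = 0"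
    using assms unfolding lm_order_def lm_explicit_def by (auto dest!: bspec[of _ _ 1])
  then have "(\<Sum>j=1..k. \<beta> j) = (\<Sum>j=1..k. real j * \<alpha> j)" by (simp add: sum_subtractf)
  moreover have "(\<Sum>j=1..k. \<alpha> j) \<le> (\<Sum>j=1..k. real j * \<alpha> j)"
  proof (rule sum_mono)
    fix j assume "j \<in> {1..k}"
    then show "\<alpha> j \<le> real j * \<alpha> j"
      using True mult_right_mono[of 1 "real j" "\<alpha> j"] by simp
  qed
  ultimately have s2: "(\<Sum>j=1..k. \<beta> j) \<ge> (\<Sum>j=1..k. \<alpha> j)" by simp
  have "\<exists>j\<in>{1..k}. \<beta> j \<noteq> 0 \<and> \<alpha> j \<le> \<beta> j"
  proof (rule ccontr)
    assume H: "\<not> ?thesis"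
    have le: "\<beta> j \<le> \<alpha> j" if "j \<in> {1..k}" for j
      using H True that by (cases "\<beta> j = 0") force+
    have "\<exists>j\<in>{1..k}. \<beta> j \<noteq> 0"
    proof (rule ccontr)
      assume "\<not> ?thesis"
      then have "(\<Sum>j=1..k. \<beta> j) = 0" by simp
      then show False using s1 s2 by simp
    qed
    then obtain i where i: "i \<in> {1..k}" "\<beta> i \<noteq> 0" by blast
    have "\<beta> i < \<alpha> i" using H i by force
    then have "(\<Sum>j=1..k. \<beta> j) < (\<Sum>j=1..k. \<alpha> j)"
      using le i by (intro sum_strict_mono_ex1) auto
    then show False using s2 by simp
  qed
  then obtain j where j: "j \<in> {1..k}" "\<beta> j \<noteq> 0" "\<alpha> j \<le> \<beta> j" by blast
  have "\<beta> j > 0" using True j by force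
  then have "ereal (\<alpha> j / \<beta> j) \<le> 1" using j by simp
  with j have "(INF j\<in>{j\<in>{1..k}. \<beta> j \<noteq> 0}. ereal (\<alpha> j / \<beta> j)) \<le> 1"
    by (intro INF_lower2[of j]) auto
  then show ?thesis using True unfolding ssp_coeff_def by simp
qed (unfold ssp_coeff_def, auto)

lemma C_exp_le_1: "p \<ge> 1 \<Longrightarrow> C_exp k p \<le> 1"
  unfolding C_exp_def Let_def by (auto intro!: Sup_least ssp_coeff_le_1[of p])

lemma C_exp_Suc: "C_exp k p \<le> C_exp (Suc k) p"
proof -
  have "ssp_coeff k \<alpha> \<beta> \<le> C_exp (Suc k) p" if "lm_explicit \<beta>" "lm_order k \<alpha> \<beta> p" for \<alpha> \<beta>
  proof -
    define a where "a = \<alpha>(Suc k := 0)"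
    define b where "b = \<beta>(Suc k := 0)"
    have "lm_explicit b" using that by (simp add: lm_explicit_def b_def)
    moreover have "lm_order (Suc k) a b p"
      using that by (simp add: lm_order_def a_def b_def)
    moreover have "ssp_coeff (Suc k) a b = ssp_coeff k \<alpha> \<beta>"
    proof -
      have "(\<forall>j\<in>{1..Suc k}. a j \<ge> 0) \<longleftrightarrow> (\<forall>j\<in>{1..k}. \<alpha> j \<ge> 0)"
        "(\<forall>j\<in>{0..Suc k}. b j \<ge> 0) \<longleftrightarrow> (\<forall>j\<in>{0..k}. \<beta> j \<ge> 0)"
        by (auto simp: a_def b_def atLeastAtMostSuc_conv le_Suc_eq)
      moreover have "{j\<in>{1..Suc k}. b j \<noteq> 0} = {j\<in>{1..k}. \<beta> j \<noteq> 0}"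
        by (auto simp: b_def)
      moreover have "(INF j\<in>{j\<in>{1..k}. \<beta> j \<noteq> 0}. ereal (a j / b j)) =
          (INF j\<in>{j\<in>{1..k}. \<beta> j \<noteq> 0}. ereal (\<alpha> j / \<beta> j))"
        by (intro INF_cong) (auto simp: a_def b_def)
      ultimately show ?thesis unfolding ssp_coeff_def by simp
    qed
    ultimately have "ssp_coeff k \<alpha> \<beta> \<in>
        {ssp_coeff (Suc k) \<alpha> \<beta> | \<alpha> \<beta>. lm_explicit \<beta> \<and> lm_order (Suc k) \<alpha> \<beta> p}" by force
    then show ?thesis unfolding C_exp_def Let_def by (auto intro: Sup_upper)
  qed
  then show ?thesis
    using C_exp_nonneg[of "Suc k" p]
    by (subst C_exp_def) (auto simp: Let_def intro!: Sup_least)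
qed

lemma C_exp_tendsto: "(\<lambda>k. C_exp k p) \<longlonglongrightarrow> C_exp_inf p"
proof -
  have "incseq (\<lambda>k. C_exp k p)" by (intro incseq_SucI C_exp_Suc)
  then have "convergent (\<lambda>k. C_exp k p)" using LIMSEQ_SUP by (auto simp: convergent_def)
  then show ?thesis unfolding C_exp_inf_def by (simp add: convergent_LIMSEQ_iff)
qed

end

theory Submission
  imports Defs "HOL-Computational_Algebra.Polynomial" "HOL-Real_Asymp.Real_Asymp"
begin

text \<open>
  An explicit method of order \<open>p\<close> with coefficient at least \<open>g > 0\<close> is a nonnegative combination
  of the functionals \<open>q \<mapsto> q(j)\<close> and \<open>q \<mapsto> g q(j) - q'(j)\<close>, \<open>1 \<le> j \<le> k\<close>, that equals \<open>q \<mapsto> q(0)\<close>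
  on polynomials of degree at most \<open>p\<close>. By Farkas' lemma, the obstruction is a polynomial with
  \<open>q(0) < 0\<close>, \<open>q(j) \<ge> 0\<close> and \<open>q'(j) \<le> g q(j)\<close>. Such a polynomial is never optimal if its degree is
  even: it has a negative root, and dividing by the corresponding factor decreases \<open>q' / q\<close>. Hence,
  for \<open>p\<close> odd and \<open>g\<close> the limit of the optimal coefficients, there is no obstruction of degree at
  most \<open>p + 1\<close>, and finitely many nodes together with a node at infinity represent \<open>q(0)\<close> in this
  degree. In degree \<open>p\<close> the node at infinity vanishes, which gives the first part; replacing it by
  a distant node gives the upper bound of the second part. The lower bound comes from multiplying
  test polynomials by \<open>k - x\<close>.
\<close>

section \<open>Linear functionals on polynomials\<close>

definition poly_linear :: "(real poly \<Rightarrow> real) \<Rightarrow> bool" where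
  "poly_linear f \<longleftrightarrow> (\<forall>p q. f (p + q) = f p + f q) \<and> (\<forall>c p. f (smult c p) = c * f p)"

lemma poly_linear_add: "poly_linear f \<Longrightarrow> f (p + q) = f p + f q"
  and poly_linear_smult: "poly_linear f \<Longrightarrow> f (smult c p) = c * f p"
  by (simp_all add: poly_linear_def)

lemma poly_linear_diff: "poly_linear f \<Longrightarrow> f (p - q) = f p - f q"
  using poly_linear_add[of f p "smult (- 1) q"] poly_linear_smult[of f "- 1" q] by simp

lemma poly_linear_zero: "poly_linear f \<Longrightarrow> f 0 = 0"
  using poly_linear_smult[of f 0 0] by simp

lemma poly_linear_sum: "poly_linear f \<Longrightarrow> f (sum g A) = (\<Sum>x\<in>A. f (g x))"
  by (induction A rule: infinite_finite_induct) (auto simp: poly_linear_zero poly_linear_add)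

lemma poly_linear_coeffs:
  assumes "poly_linear f" "degree q \<le> n"
  shows "f q = (\<Sum>m\<le>n. coeff q m * f (monom 1 m))"
proof -
  have "f q = f (\<Sum>m\<le>n. monom (coeff q m) m)"
    using assms(2) by (simp add: poly_as_sum_of_monoms')
  also have "\<dots> = (\<Sum>m\<le>n. f (smult (coeff q m) (monom 1 m)))"
    by (simp add: poly_linear_sum[OF assms(1)] smult_monom)
  finally show ?thesis by (simp add: poly_linear_smult[OF assms(1)])
qed

text \<open>
  Bartl's algebraic proof: if \<open>x\<close> satisfies all constraints but the last one, \<open>f i\<close>, then every
  functional can be restricted to the kernel of \<open>f i\<close> by projecting along \<open>x\<close>.
\<close>

lemma farkas:
  fixes f :: "'j \<Rightarrow> real poly \<Rightarrow> real"
  assumes "finite J" "\<And>j. j \<in> J \<Longrightarrow> poly_linear (f j)" "poly_linear b"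
    and "\<And>q. degree q \<le> n \<Longrightarrow> (\<And>j. j \<in> J \<Longrightarrow> 0 \<le> f j q) \<Longrightarrow> 0 \<le> b q"
  shows "\<exists>c. (\<forall>j\<in>J. 0 \<le> c j) \<and> (\<forall>q. degree q \<le> n \<longrightarrow> b q = (\<Sum>j\<in>J. c j * f j q))"
  using assms
proof (induction J arbitrary: f b rule: finite_induct)
  case empty
  have "b q = 0" if "degree q \<le> n" for q
    using empty.prems(3)[of q] empty.prems(3)[of "- q"] that
      poly_linear_diff[OF empty.prems(2), of 0 q] poly_linear_zero[OF empty.prems(2)] by simp
  then show ?case by auto
next
  case (insert i J)
  have lin: "poly_linear (f j)" if "j \<in> J" for j using insert.prems(1) that by simp
  have lini: "poly_linear (f i)" using insert.prems(1) by simp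
  note linb = insert.prems(2)
  show ?case
  proof (cases "\<forall>q. degree q \<le> n \<longrightarrow> (\<forall>j\<in>J. 0 \<le> f j q) \<longrightarrow> 0 \<le> b q")
    case True
    then obtain c where c: "\<forall>j\<in>J. 0 \<le> c j" "\<forall>q. degree q \<le> n \<longrightarrow> b q = (\<Sum>j\<in>J. c j * f j q)"
      using insert.IH[of f b] lin linb by blast
    have "(\<Sum>j\<in>insert i J. (c(i := 0)) j * f j q) = (\<Sum>j\<in>J. c j * f j q)" for q
      using insert.hyps by (simp, intro sum.cong) auto
    then show ?thesis using c by (intro exI[of _ "c(i := 0)"]) auto
  next
    case False
    then obtain x where x: "degree x \<le> n" "\<And>j. j \<in> J \<Longrightarrow> 0 \<le> f j x" "b x < 0"
      by (auto simp: not_le)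
    define a where "a = f i x"
    have a: "a < 0" using insert.prems(3)[of x] x by (force simp: a_def)
    \<comment> \<open>Both are the old functionals composed with the projection
      \<open>q - (f i q / a) x\<close> onto the kernel of \<open>f i\<close>.\<close>
    define f' where "f' j q = f j q - f j x / a * f i q" for j q
    define b' where "b' q = b q - b x / a * f i q" for q
    have "poly_linear (f' j)" if "j \<in> J" for j
      using lin[OF that] lini by (simp add: f'_def poly_linear_def algebra_simps)
    moreover have "poly_linear b'"
      using linb lini by (simp add: b'_def poly_linear_def algebra_simps)
    moreover have "0 \<le> b' q" if q: "degree q \<le> n" "\<And>j. j \<in> J \<Longrightarrow> 0 \<le> f' j q" for q
    proof -
      define y where "y = q - smult (f i q / a) x"
      have deg: "degree y \<le> n"
        unfolding y_def using q(1) x(1) by (intro degree_diff_le) (auto intro: le_trans[OF degree_smult_le])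
      have "f j y = f' j q" if "j \<in> J" for j
        using lin[OF that] by (simp add: y_def f'_def poly_linear_diff poly_linear_smult)
      moreover have "f i y = 0"
        using lini a by (simp add: y_def poly_linear_diff poly_linear_smult a_def)
      moreover have "b y = b' q"
        using linb by (simp add: y_def b'_def poly_linear_diff poly_linear_smult)
      ultimately show ?thesis using insert.prems(3)[of y] deg q(2) by (metis insert_iff order_refl)
    qed
    ultimately obtain c where c: "\<forall>j\<in>J. 0 \<le> c j"
        "\<forall>q. degree q \<le> n \<longrightarrow> b' q = (\<Sum>j\<in>J. c j * f' j q)"
      using insert.IH[of f' b'] by blast
    \<comment> \<open>Collects every multiple of \<open>f i\<close> produced by undoing the
      projection; numerator and denominator of \<open>ci\<close> are both negative.\<close>
    define ci where "ci = b x / a - (\<Sum>j\<in>J. c j * f j x) / a"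
    have "0 \<le> (\<Sum>j\<in>J. c j * f j x)" using c(1) x(2) by (intro sum_nonneg) simp
    then have "0 \<le> ci" using a x(3) by (simp add: ci_def diff_divide_distrib[symmetric] zero_le_divide_iff)
    moreover have "b q = ci * f i q + (\<Sum>j\<in>J. c j * f j q)" if "degree q \<le> n" for q
    proof -
      have "b q = b x / a * f i q + (\<Sum>j\<in>J. c j * f' j q)"
        using c(2) that by (simp add: b'_def algebra_simps)
      also have "(\<Sum>j\<in>J. c j * f' j q) = (\<Sum>j\<in>J. c j * f j q) - (\<Sum>j\<in>J. c j * f j x) / a * f i q"
        by (simp add: f'_def algebra_simps sum_subtractf sum_distrib_left sum_divide_distrib)
      finally show ?thesis by (simp add: ci_def algebra_simps)
    qed
    moreover have "(\<Sum>j\<in>insert i J. (c(i := ci)) j * f j q) = ci * f i q + (\<Sum>j\<in>J. c j * f j q)" for q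
      using insert.hyps by (simp, intro sum.cong) auto
    ultimately show ?thesis using c(1) by (intro exI[of _ "c(i := ci)"]) auto
  qed
qed

text \<open>Bolzano-Weierstrass, one coordinate at a time: a monotone subsequence of a bounded
  coordinate converges.\<close>

lemma bounded_family_subseq:
  fixes x :: "nat \<Rightarrow> 'i \<Rightarrow> real"
  assumes "finite I" "\<And>k m. m \<in> I \<Longrightarrow> \<bar>x k m\<bar> \<le> B"
  shows "\<exists>r y. strict_mono r \<and> (\<forall>m\<in>I. (\<lambda>k. x (r k) m) \<longlonglongrightarrow> y m)"
  using assms
proof (induction I rule: finite_induct)
  case empty
  show ?case using strict_mono_id by blast
next
  case (insert i I)
  then obtain r y where r: "strict_mono r" "\<forall>m\<in>I. (\<lambda>k. x (r k) m) \<longlonglongrightarrow> y m" by force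
  obtain s :: "nat \<Rightarrow> nat" where s: "strict_mono s" "monoseq (\<lambda>k. x (r (s k)) i)"
    using seq_monosub[of "\<lambda>k. x (r k) i"] by auto
  have "Bseq (\<lambda>k. x (r (s k)) i)" using insert.prems by (intro BseqI'[of _ B]) auto
  then obtain l where l: "(\<lambda>k. x (r (s k)) i) \<longlonglongrightarrow> l"
    using Bseq_monoseq_convergent[OF _ s(2)] by (auto simp: convergent_def)
  have "(\<lambda>k. x (r (s k)) m) \<longlonglongrightarrow> y m" if "m \<in> I" for m
    using LIMSEQ_subseq_LIMSEQ[OF bspec[OF r(2) that] s(1)] by (simp add: o_def)
  then have "\<forall>m\<in>insert i I. (\<lambda>k. x ((r \<circ> s) k) m) \<longlonglongrightarrow> (y(i := l)) m"
    using l insert.hyps by auto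
  then show ?case using strict_mono_o[OF r(1) s(1)] by blast
qed

text \<open>Farkas gives a strict separator for each \<open>J k\<close>. Normalised separators have
  a convergent subsequence; its limit satisfies all constraints at once, but strictness at
  \<open>b\<close> may be lost, so \<open>u \<noteq> 0\<close> is recorded instead.\<close>

lemma weak_separation:
  fixes f :: "'j \<Rightarrow> real poly \<Rightarrow> real"
  assumes "\<And>k. finite (J k)" "incseq J" and lin: "\<And>j. poly_linear (f j)" "poly_linear b"
    and no: "\<And>k c. (\<And>j. j \<in> J k \<Longrightarrow> 0 \<le> c j) \<Longrightarrow> \<exists>q. degree q \<le> n \<and> b q \<noteq> (\<Sum>j\<in>J k. c j * f j q)"
  shows "\<exists>u. u \<noteq> 0 \<and> degree u \<le> n \<and> (\<forall>k. \<forall>j\<in>J k. 0 \<le> f j u) \<and> b u \<le> 0"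
proof -
  have "\<forall>k. \<exists>q. degree q \<le> n \<and> (\<forall>j\<in>J k. 0 \<le> f j q) \<and> b q < 0"
  proof (rule allI, rule ccontr)
    fix k
    assume H: "\<nexists>q. degree q \<le> n \<and> (\<forall>j\<in>J k. 0 \<le> f j q) \<and> b q < 0"
    then have "0 \<le> b q" if "degree q \<le> n" "\<And>j. j \<in> J k \<Longrightarrow> 0 \<le> f j q" for q
      using that by (auto simp: not_less)
    from farkas[where J = "J k" and f = f and b = b, OF assms(1) lin this]
    obtain c where c: "\<forall>j\<in>J k. 0 \<le> c j"
        "\<forall>q. degree q \<le> n \<longrightarrow> b q = (\<Sum>j\<in>J k. c j * f j q)" by blast
    then show False using no[of k c] by blast
  qed
  from choice[OF this]
  obtain x where "\<forall>k. degree (x k) \<le> n \<and> (\<forall>j\<in>J k. 0 \<le> f j (x k)) \<and> b (x k) < 0" ..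
  then have x: "\<And>k. degree (x k) \<le> n" "\<And>k j. j \<in> J k \<Longrightarrow> 0 \<le> f j (x k)" "\<And>k. b (x k) < 0"
    by auto
  define N where "N k = (\<Sum>m\<le>n. \<bar>coeff (x k) m\<bar>)" for k
  have N: "N k > 0" for k
  proof -
    have "x k \<noteq> 0" using x(3)[of k] poly_linear_zero[OF lin(2)] by auto
    then have "coeff (x k) (degree (x k)) \<noteq> 0" by simp
    then show ?thesis unfolding N_def using x(1)[of k]
      by (intro sum_pos2[of _ "degree (x k)"]) auto
  qed
  define z where "z k m = coeff (x k) m / N k" for k m
  have "\<bar>z k m\<bar> \<le> 1" if "m \<in> {..n}" for k m
    using N[of k] that member_le_sum[of m "{..n}" "\<lambda>m. \<bar>coeff (x k) m\<bar>"]
    by (simp add: z_def N_def[symmetric])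
  then obtain r y where r: "strict_mono r" "\<forall>m\<in>{..n}. (\<lambda>k. z (r k) m) \<longlonglongrightarrow> y m"
    using bounded_family_subseq[of "{..n}" z 1] by auto
  define u where "u = (\<Sum>m\<le>n. monom (y m) m)"
  have coeff_u: "coeff u m = (if m \<le> n then y m else 0)" for m
    by (simp add: u_def coeff_sum)
  have deg_u: "degree u \<le> n" by (intro degree_le) (simp add: coeff_u)
  have lim: "(\<lambda>k. g (x (r k)) / N (r k)) \<longlonglongrightarrow> g u" if "poly_linear g" for g
  proof -
    have "g (x k) / N k = (\<Sum>m\<le>n. z k m * g (monom 1 m))" for k
      by (subst poly_linear_coeffs[OF that x(1)]) (simp add: z_def sum_divide_distrib)
    moreover have "g u = (\<Sum>m\<le>n. y m * g (monom 1 m))"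
      by (subst poly_linear_coeffs[OF that deg_u]) (simp add: coeff_u)
    ultimately show ?thesis using r(2) by (auto intro!: tendsto_intros)
  qed
  \<comment> \<open>The coefficient vectors have l1 norm 1, and so does their limit, which is
    therefore non-zero.\<close>
  have "(\<lambda>k. \<Sum>m\<le>n. \<bar>z (r k) m\<bar>) \<longlonglongrightarrow> (\<Sum>m\<le>n. \<bar>y m\<bar>)"
    using r(2) by (auto intro!: tendsto_intros)
  moreover have "(\<Sum>m\<le>n. \<bar>z k m\<bar>) = 1" for k
    using N[of k] by (simp add: z_def sum_divide_distrib[symmetric] N_def[symmetric])
  ultimately have "(\<Sum>m\<le>n. \<bar>y m\<bar>) = 1" using LIMSEQ_unique[OF _ tendsto_const] by simp
  then have "u \<noteq> 0" using coeff_u by (metis (no_types, lifting) abs_zero atMost_iff coeff_0 sum.neutral zero_neq_one)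
  moreover have "0 \<le> f j u" if "j \<in> J k" for j k
  proof (rule LIMSEQ_le_const[OF lim[OF lin(1)]], intro exI allI impI)
    fix i assume "k \<le> i"
    then have "j \<in> J (r i)"
      using that assms(2) seq_suble[OF r(1), of i] by (meson incseqD le_trans subsetD)
    then show "0 \<le> f j (x (r i)) / N (r i)" using x(2)[of j "r i"] N[of "r i"] by (simp add: less_imp_le)
  qed
  moreover have "b u \<le> 0"
    using x(3) N by (intro LIMSEQ_le_const2[OF lim[OF lin(2)]])
      (auto simp: divide_le_0_iff less_imp_le)
  ultimately show ?thesis using deg_u by blast
qed

section \<open>Methods as representations of the evaluation at zero\<close>

text \<open>
  With \<open>\<alpha> j = \<delta> j + \<gamma> j * \<beta> j\<close> and \<open>c = 0\<close> this is an explicit method of order \<open>n\<close>. The functional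
  \<open>coeff _ n\<close> is the limit of the functionals \<open>q \<mapsto> q(N) / N^n\<close>, that is, a node at infinity.
\<close>

definition represents ::
    "(nat \<Rightarrow> real) \<Rightarrow> nat \<Rightarrow> nat \<Rightarrow> (nat \<Rightarrow> real) \<Rightarrow> (nat \<Rightarrow> real) \<Rightarrow> real \<Rightarrow> bool" where
  "represents \<gamma> n k \<delta> \<beta> c \<longleftrightarrow>
     (\<forall>j\<in>{1..k}. 0 \<le> \<delta> j \<and> 0 \<le> \<beta> j) \<and> 0 \<le> c \<and>
     (\<forall>q. degree q \<le> n \<longrightarrow>
        poly q 0 = (\<Sum>j=1..k. \<delta> j * poly q (real j) +
                              \<beta> j * (\<gamma> j * poly q (real j) - poly (pderiv q) (real j)))
                   + c * coeff q n)"

text \<open>A single index type for the three kinds of functional lets Farkas' lemma act on one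
  increasing family of finite sets.\<close>

datatype node = Val nat | Der nat | Top

fun node_eval :: "(nat \<Rightarrow> real) \<Rightarrow> nat \<Rightarrow> node \<Rightarrow> real poly \<Rightarrow> real" where
  "node_eval \<gamma> n (Val j) q = poly q (real j)"
| "node_eval \<gamma> n (Der j) q = \<gamma> j * poly q (real j) - poly (pderiv q) (real j)"
| "node_eval \<gamma> n Top q = coeff q n"

definition nodes :: "nat \<Rightarrow> node set" where
  "nodes k = Val ` {1..k} \<union> Der ` {1..k} \<union> {Top}"

lemma poly_linear_node_eval: "poly_linear (node_eval \<gamma> n i)"
  by (cases i) (auto simp: poly_linear_def pderiv_add pderiv_smult algebra_simps)

lemma poly_linear_poly: "poly_linear (\<lambda>q. poly q x)"
  by (simp add: poly_linear_def)

lemma finite_nodes: "finite (nodes k)"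
  by (simp add: nodes_def)

lemma incseq_nodes: "incseq nodes"
  by (auto simp: incseq_def nodes_def)

lemma sum_nodes:
  "(\<Sum>i\<in>nodes k. g i) = (\<Sum>j=1..k. g (Val j) + g (Der j)) + (g Top :: real)"
proof -
  have "(\<Sum>i\<in>nodes k. g i) = (\<Sum>i\<in>Val ` {1..k}. g i) + (\<Sum>i\<in>Der ` {1..k}. g i) + g Top"
    unfolding nodes_def by (subst sum.union_disjoint; auto)+
  then show ?thesis by (simp add: sum.reindex inj_on_def sum.distrib)
qed

lemma represents_nodes:
  assumes "\<And>i. i \<in> nodes k \<Longrightarrow> 0 \<le> c i"
    and "\<And>q. degree q \<le> n \<Longrightarrow> poly q 0 = (\<Sum>i\<in>nodes k. c i * node_eval \<gamma> n i q)"
  shows "represents \<gamma> n k (\<lambda>j. c (Val j)) (\<lambda>j. c (Der j)) (c Top)"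
  using assms(1) unfolding represents_def
  by (auto simp: assms(2) sum_nodes) (auto simp: nodes_def)

text \<open>The sign of \<open>coeff u n\<close> is not recorded: it follows from nonnegativity at
  the integers.\<close>

lemma weak_dual:
  assumes "\<nexists>k \<delta> \<beta> c. represents \<gamma> n k \<delta> \<beta> c"
  obtains u where "u \<noteq> 0" "degree u \<le> n" "poly u 0 \<le> 0"
    "\<And>j. 1 \<le> j \<Longrightarrow> 0 \<le> poly u (real j)"
    "\<And>j. 1 \<le> j \<Longrightarrow> poly (pderiv u) (real j) \<le> \<gamma> j * poly u (real j)"
proof -
  have no: "\<exists>q. degree q \<le> n \<and> poly q 0 \<noteq> (\<Sum>i\<in>nodes k. c i * node_eval \<gamma> n i q)"
    if "\<And>i. i \<in> nodes k \<Longrightarrow> 0 \<le> c i" for k c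
    using represents_nodes[of k c n \<gamma>] that assms by metis
  obtain u where u: "u \<noteq> 0" "degree u \<le> n" "poly u 0 \<le> 0"
      "\<forall>k. \<forall>i\<in>nodes k. 0 \<le> node_eval \<gamma> n i u"
    using weak_separation[where J = nodes and f = "node_eval \<gamma> n" and b = "\<lambda>q. poly q 0" and n = n,
        OF finite_nodes incseq_nodes poly_linear_node_eval poly_linear_poly no] by metis
  show thesis
  proof (rule that[OF u(1-3)])
    fix j :: nat assume "1 \<le> j"
    then have "Val j \<in> nodes j" "Der j \<in> nodes j" by (auto simp: nodes_def)
    then show "0 \<le> poly u (real j)" "poly (pderiv u) (real j) \<le> \<gamma> j * poly u (real j)"
      using u(4) by (metis node_eval.simps(1), metis node_eval.simps(2) diff_ge_0_iff_ge)
  qed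
qed

section \<open>Behaviour of polynomials at infinity\<close>

lemma eventually_poly_pos:
  assumes "0 < lead_coeff (q :: real poly)"
  shows "\<forall>\<^sub>F x in at_top. 0 < poly q x"
  using poly_pinfty_gt_lc[OF assms] assms
  by (auto simp: eventually_at_top_linorder intro: less_le_trans)

lemma lead_coeff_nonneg_if_nat:
  assumes "\<And>j. 1 \<le> j \<Longrightarrow> 0 \<le> poly q (real j)"
  shows "0 \<le> lead_coeff (q :: real poly)"
proof (rule ccontr)
  assume "\<not> ?thesis"
  then have "\<forall>\<^sub>F x in at_top. 0 < poly (- q) x" by (intro eventually_poly_pos) simp
  then obtain b where "\<And>x. b \<le> x \<Longrightarrow> poly q x < 0" by (auto simp: eventually_at_top_linorder)
  moreover obtain j :: nat where "b \<le> real j" "1 \<le> j"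
    by (metis max.bounded_iff of_nat_max real_arch_simple max.cobounded1 max.cobounded2 order_trans of_nat_mono)
  ultimately show False using assms[of j] by force
qed

text \<open>\<open>g q - q'\<close> has the degree of \<open>q\<close> and leading coefficient
  \<open>g * lead_coeff q\<close>.\<close>

lemma eventually_deriv_less:
  assumes "0 < lead_coeff (q :: real poly)" "0 < g"
  shows "\<forall>\<^sub>F x in at_top. poly (pderiv q) x < g * poly q x"
proof -
  let ?r = "smult g q - pderiv q"
  have "coeff ?r (degree q) = g * lead_coeff q"
    by (simp add: coeff_pderiv coeff_eq_0)
  moreover have "degree ?r \<le> degree q"
    by (intro degree_diff_le) (auto simp: degree_pderiv)
  ultimately have "0 < lead_coeff ?r"
    using assms by (metis le_antisym le_degree less_irrefl mult_pos_pos)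
  from eventually_poly_pos[OF this] show ?thesis by (rule eventually_mono) simp
qed

text \<open>In even degree \<open>q(-x)\<close> keeps the leading coefficient, so \<open>q\<close>
  is positive far to the left and changes sign before 0.\<close>

lemma neg_root_if_even_degree:
  assumes "even (degree q)" "0 < lead_coeff (q :: real poly)" "poly q 0 < 0"
  obtains a where "0 < a" "poly q (- a) = 0"
proof -
  let ?r = "pcompose q [:0, - 1:]"
  have "0 < lead_coeff ?r" using assms by (subst lead_coeff_comp) auto
  then have "\<forall>\<^sub>F x in at_top. 0 < poly ?r x \<and> 1 \<le> x"
    using eventually_poly_pos eventually_ge_at_top by (intro eventually_conj) auto
  then obtain b where b: "0 < poly q (- b)" "1 \<le> b"
    by (force simp: poly_pcompose eventually_at_top_linorder)
  from poly_IVT_neg[of "- b" 0 q] b assms obtain x where "x < 0" "poly q x = 0" by auto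
  then show thesis using that[of "- x"] by simp
qed


section \<open>Strong duality with a node at infinity\<close>

text \<open>
  A weakly separating \<open>u\<close> is tight at finitely many nodes only, and there it can be perturbed to make
  the value at zero negative. The result has even degree, hence a negative root \<open>- a\<close>; dividing by
  \<open>x + a\<close> lowers the logarithmic derivative, which is the gain from \<open>g\<close> to \<open>g'\<close>.
\<close>

lemma strict_dual:
  assumes "odd p" "0 < g" and no: "\<nexists>k \<delta> \<beta> c. represents (\<lambda>_. g) (Suc p) k \<delta> \<beta> c"
  obtains t g' where "degree t \<le> p" "poly t 0 < 0" "0 < g'" "g' < g"
    "\<And>j. 1 \<le> j \<Longrightarrow> 0 \<le> poly t (real j)"
    "\<And>j. 1 \<le> j \<Longrightarrow> poly (pderiv t) (real j) \<le> g' * poly t (real j)"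
proof -
  define n where "n = Suc p"
  define ev where "ev = node_eval (\<lambda>_. g) n"
  have ev_lin: "poly_linear (ev i)" for i by (simp add: ev_def poly_linear_node_eval)
  obtain u where u: "u \<noteq> 0" "degree u \<le> n" "poly u 0 \<le> 0"
      "\<And>j. 1 \<le> j \<Longrightarrow> 0 \<le> poly u (real j)"
      "\<And>j. 1 \<le> j \<Longrightarrow> poly (pderiv u) (real j) \<le> g * poly u (real j)"
    using weak_dual[OF no] unfolding n_def by blast
  have lu: "0 < lead_coeff u"
    using lead_coeff_nonneg_if_nat[OF u(4)] u(1) by (simp add: le_less)
  then have un: "0 \<le> coeff u n"
    using u(2) by (cases "degree u = n") (auto simp: coeff_eq_0)
  obtain x0 where x0: "\<And>x. x0 \<le> x \<Longrightarrow> 0 < poly u x \<and> poly (pderiv u) x < g * poly u x"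
    using eventually_conj[OF eventually_poly_pos[OF lu] eventually_deriv_less[OF lu assms(2)]]
    by (auto simp: eventually_at_top_linorder)
  obtain K :: nat where K: "x0 \<le> real K" using real_arch_simple by blast
  \<comment> \<open>All value and derivative constraints of \<open>u\<close> beyond \<open>K\<close>
    are strict. \<open>Top\<close> is included even when it is not tight, to control the leading
    coefficient of the perturbation.\<close>
  define T where "T = insert Top {i \<in> nodes K. ev i u = 0}"
  have T: "T \<subseteq> nodes K" by (auto simp: T_def nodes_def)
  have finT: "finite T" using T finite_nodes finite_subset by blast
  \<comment> \<open>Otherwise Farkas on \<open>T\<close>, with zero weights elsewhere, yields a
    forbidden representation.\<close>
  have "\<exists>s. degree s \<le> n \<and> (\<forall>i\<in>T. 0 \<le> ev i s) \<and> poly s 0 < 0"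
  proof (rule ccontr)
    assume H: "\<nexists>s. degree s \<le> n \<and> (\<forall>i\<in>T. 0 \<le> ev i s) \<and> poly s 0 < 0"
    then have "0 \<le> poly q 0" if "degree q \<le> n" "\<And>i. i \<in> T \<Longrightarrow> 0 \<le> ev i q" for q
      using that by (auto simp: not_less)
    from farkas[where J = T and f = ev and b = "\<lambda>q. poly q 0", OF finT ev_lin poly_linear_poly this]
    obtain c where c: "\<forall>i\<in>T. 0 \<le> c i" "\<forall>q. degree q \<le> n \<longrightarrow> poly q 0 = (\<Sum>i\<in>T. c i * ev i q)"
      by blast
    define c' where "c' i = (if i \<in> T then c i else 0)" for i
    have "(\<Sum>i\<in>nodes K. c' i * ev i q) = (\<Sum>i\<in>T. c i * ev i q)" for q
      using T finite_nodes by (intro sum.mono_neutral_cong_right) (auto simp: c'_def)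
    then have "represents (\<lambda>_. g) n K (\<lambda>j. c' (Val j)) (\<lambda>j. c' (Der j)) (c' Top)"
      using c by (intro represents_nodes) (auto simp: c'_def ev_def)
    then show False using no unfolding n_def by blast
  qed
  then obtain s where s: "degree s \<le> n" "\<And>i. i \<in> T \<Longrightarrow> 0 \<le> ev i s" "poly s 0 < 0" by blast
  \<comment> \<open>Large enough that \<open>x^n + A\<close> satisfies every constraint up to
    \<open>K\<close>, as \<open>g * A\<close> dominates the derivative there.\<close>
  define A where "A = (\<Sum>j=1..K. real n * real j ^ p) / g"
  have A0: "0 \<le> A" using assms(2) by (auto simp: A_def intro!: sum_nonneg divide_nonneg_pos)
  define Q where "Q = monom 1 n + [:A:]"
  have Q: "0 \<le> ev i Q" if "i \<in> nodes K" for i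
  proof (cases i)
    case (Val j)
    then show ?thesis using A0 by (simp add: ev_def Q_def poly_monom)
  next
    case (Der j)
    then have "j \<in> {1..K}" using that by (auto simp: nodes_def)
    then have "real n * real j ^ p \<le> g * A"
      using member_le_sum[of j "{1..K}" "\<lambda>j. real n * real j ^ p"] assms(2) by (simp add: A_def)
    moreover have "0 \<le> g * real j ^ n" using assms(2) by simp
    ultimately show ?thesis
      using Der by (simp add: ev_def Q_def poly_monom pderiv_add pderiv_monom pderiv_pCons
          n_def distrib_left)
  next
    case Top
    then show ?thesis by (simp add: ev_def Q_def n_def)
  qed
  \<comment> \<open>Small enough to keep \<open>S\<close> negative at 0, while \<open>e > 0\<close>
    makes its coefficient of \<open>x^n\<close> positive, so that \<open>S\<close> satisfies all
    distant constraints.\<close>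
  define e where "e = - poly s 0 / (A + 1)"
  have e: "0 < e" using s(3) A0 by (simp add: e_def divide_neg_pos)
  define S where "S = s + smult e Q"
  have "e * A < - poly s 0" using e A0 by (simp add: e_def field_simps s(3))
  then have S0: "poly S 0 < 0" by (simp add: S_def Q_def n_def poly_monom)
  have ST: "0 \<le> ev i S" if "i \<in> T" for i
    using s(2)[OF that] Q[of i] T that e
    by (auto simp: S_def poly_linear_add[OF ev_lin] poly_linear_smult[OF ev_lin])
  have degQ: "degree Q \<le> n"
    unfolding Q_def by (intro degree_add_le) (auto simp: degree_monom_eq)
  then have degS: "degree S \<le> n"
    unfolding S_def using s(1) by (intro degree_add_le) (auto intro: le_trans[OF degree_smult_le])
  have "0 \<le> coeff s n" using s(2)[of Top] by (simp add: T_def ev_def)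
  then have Sn: "0 < coeff S n" using e by (simp add: S_def Q_def n_def)
  then have "0 < lead_coeff S" using degS by (metis le_antisym le_degree less_irrefl)
  from eventually_conj[OF eventually_poly_pos[OF this] eventually_deriv_less[OF this assms(2)]]
  obtain x1 where x1: "\<And>x. x1 \<le> x \<Longrightarrow> 0 < poly S x \<and> poly (pderiv S) x < g * poly S x"
    by (auto simp: eventually_at_top_linorder)
  obtain M :: nat where M: "x1 \<le> real M" using real_arch_simple by blast
  \<comment> \<open>Tight constraints are in \<open>T\<close>, where \<open>S\<close> is
    nonnegative; the others survive a small perturbation. Beyond \<open>M\<close> both
    \<open>u\<close> and \<open>S\<close> satisfy them.\<close>
  have "\<forall>\<^sub>F r in at_right 0. 0 \<le> ev i u + r * ev i S" if i: "i \<in> nodes M" for i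
  proof (cases "ev i u = 0")
    case True
    have "i \<in> T"
    proof (cases i)
      case (Val j)
      then show ?thesis using i True x0[of "real j"] K
        by (cases "j \<le> K") (auto simp: T_def nodes_def ev_def)
    next
      case (Der j)
      then show ?thesis using i True x0[of "real j"] K
        by (cases "j \<le> K") (auto simp: T_def nodes_def ev_def)
    qed (simp add: T_def)
    then show ?thesis
      using ST True by (auto simp: eventually_at_right_less intro!: eventually_at_rightI[of 0 1])
  next
    case False
    have "0 \<le> ev i u"
      using i u(4,5) un by (auto simp: nodes_def ev_def)
    moreover have "((\<lambda>r. ev i u + r * ev i S) \<longlongrightarrow> ev i u + 0 * ev i S) (at_right 0)"
      by (intro tendsto_intros)
    ultimately have "\<forall>\<^sub>F r in at_right 0. 0 < ev i u + r * ev i S"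
      using False by (intro order_tendstoD(1)) auto
    then show ?thesis by (rule eventually_mono) simp
  qed
  then have "\<forall>\<^sub>F r in at_right (0::real). 0 < r \<and> (\<forall>i\<in>nodes M. 0 \<le> ev i u + r * ev i S)"
    using finite_nodes by (intro eventually_conj eventually_ball_finite eventually_at_right_less) auto
  then obtain r where r: "0 < r" "\<forall>i\<in>nodes M. 0 \<le> ev i u + r * ev i S"
    using eventually_happens'[OF trivial_limit_at_right_real] by blast
  define v where "v = u + smult r S"
  have ev_v: "ev i v = ev i u + r * ev i S" for i
    by (simp add: v_def poly_linear_add[OF ev_lin] poly_linear_smult[OF ev_lin])
  have v: "0 \<le> poly v (real j)" "poly (pderiv v) (real j) \<le> g * poly v (real j)" if "1 \<le> j" for j
  proof -
    have "0 \<le> ev (Val j) v \<and> 0 \<le> ev (Der j) v"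
    proof (cases "j \<le> M")
      case True
      then have "Val j \<in> nodes M" "Der j \<in> nodes M" using that by (auto simp: nodes_def)
      then show ?thesis using r(2) by (simp add: ev_v)
    next
      case False
      then have "0 \<le> ev (Val j) S" "0 \<le> ev (Der j) S"
        using x1[of "real j"] M by (auto simp: ev_def)
      moreover have "0 \<le> ev (Val j) u" "0 \<le> ev (Der j) u"
        using u(4,5) that by (auto simp: ev_def)
      ultimately show ?thesis using r(1) by (simp add: ev_v)
    qed
    then show "0 \<le> poly v (real j)" "poly (pderiv v) (real j) \<le> g * poly v (real j)"
      by (auto simp: ev_def)
  qed
  have v0: "poly v 0 < 0"
    using u(3) mult_pos_neg[OF r(1) S0] by (simp add: v_def)
  have vn: "0 < coeff v n" using un mult_pos_pos[OF r(1) Sn] by (simp add: v_def)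
  have "degree v \<le> n"
    unfolding v_def using u(2) degS by (intro degree_add_le) (auto intro: le_trans[OF degree_smult_le])
  with vn have degv: "degree v = n" by (metis le_antisym le_degree less_irrefl)
  obtain a where a: "0 < a" "poly v (- a) = 0"
    using neg_root_if_even_degree[of v] v0 vn assms(1) degv n_def by auto
  then obtain t where t: "v = [:a, 1:] * t" by (auto simp: poly_eq_0_iff_dvd dvd_def)
  have "v \<noteq> 0" using v0 by auto
  then have "t \<noteq> 0" using t by auto
  then have degt: "degree t = p" using degv t by (simp add: degree_mult_eq n_def del: mult_pCons_left)
  have "lead_coeff v = lead_coeff t" unfolding t lead_coeff_mult by simp
  then have lt: "0 < lead_coeff t" using vn degv by simp
  obtain x2 where x2: "\<And>x. x2 \<le> x \<Longrightarrow> poly (pderiv t) x < g / 2 * poly t x"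
    using eventually_deriv_less[OF lt, of "g / 2"] assms(2) by (auto simp: eventually_at_top_linorder)
  obtain L :: nat where L: "x2 \<le> real L" using real_arch_simple by blast
  \<comment> \<open>From \<open>L\<close> on, \<open>t' \<le> (g / 2) t\<close>. Before
    \<open>L\<close>, dividing \<open>v\<close> by \<open>x + a\<close> lowers the logarithmic
    derivative by \<open>1 / (j + a)\<close>, which is at least \<open>1 / (L + a)\<close>.\<close>
  define h where "h = min (g / 2) (1 / (real L + a))"
  have h: "0 < h" "h \<le> g / 2" "h \<le> 1 / (real L + a)"
    using assms(2) a(1) by (auto simp: h_def)
  have t_nonneg: "0 \<le> poly t (real j)" if "1 \<le> j" for j
  proof -
    have "poly v (real j) = (real j + a) * poly t (real j)" by (simp add: t algebra_simps)
    then show ?thesis using v(1)[OF that] a(1) by (simp add: zero_le_mult_iff)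
  qed
  show thesis
  proof (rule that[of t "g - h"])
    show "degree t \<le> p" using degt by simp
    have "poly v 0 = a * poly t 0" by (simp add: t)
    then show "poly t 0 < 0" using v0 a(1) by (simp add: mult_less_0_iff)
    show "0 < g - h" "g - h < g" using h assms(2) by auto
  next
    fix j :: nat assume j: "1 \<le> j"
    show "0 \<le> poly t (real j)" using t_nonneg[OF j] .
    show "poly (pderiv t) (real j) \<le> (g - h) * poly t (real j)"
    proof (cases "L \<le> j")
      case True
      then have "poly (pderiv t) (real j) < g / 2 * poly t (real j)" using x2 L by force
      also have "\<dots> \<le> (g - h) * poly t (real j)"
        using h t_nonneg[OF j] by (intro mult_right_mono) auto
      finally show ?thesis by simp
    next
      case False
      define d where "d = real j + a"
      have d: "0 < d" using a(1) by (simp add: d_def)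
      have "poly (pderiv v) (real j) = poly t (real j) + d * poly (pderiv t) (real j)"
        unfolding t pderiv_mult by (simp add: d_def pderiv_pCons algebra_simps)
      moreover have "poly v (real j) = d * poly t (real j)" by (simp add: t d_def algebra_simps)
      ultimately have "d * poly (pderiv t) (real j) \<le> d * ((g - 1 / d) * poly t (real j))"
        using v(2)[OF j] d by (simp add: algebra_simps)
      then have "poly (pderiv t) (real j) \<le> (g - 1 / d) * poly t (real j)"
        using d by (simp only: mult_le_cancel_left_pos)
      also have "h \<le> 1 / d"
        using False d a(1) by (intro order_trans[OF h(3)] divide_left_mono) (auto simp: d_def)
      then have "(g - 1 / d) * poly t (real j) \<le> (g - h) * poly t (real j)"
        using t_nonneg[OF j] by (intro mult_right_mono) auto
      finally show ?thesis .
    qed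
  qed
qed

section \<open>Optimal coefficients and representations\<close>

text \<open>Below degree \<open>n\<close> the coefficient of \<open>x^n\<close> vanishes, and the
  node at infinity with it.\<close>

lemma represents_lower_degree:
  "represents \<gamma> n k \<delta> \<beta> c \<Longrightarrow> m < n \<Longrightarrow> represents \<gamma> m k \<delta> \<beta> 0"
  by (auto simp: represents_def coeff_eq_0)

text \<open>The order conditions are the monomial cases \<open>q = x^m\<close>, with
  \<open>m = 0\<close> giving the sum of the \<open>\<alpha> j\<close>; linearity does the
  rest.\<close>

lemma lm_order_iff_poly:
  assumes "lm_explicit \<beta>"
  shows "lm_order k \<alpha> \<beta> p \<longleftrightarrow>
    (\<forall>q. degree q \<le> p \<longrightarrow>
       poly q 0 = (\<Sum>j=1..k. \<alpha> j * poly q (real j) - \<beta> j * poly (pderiv q) (real j)))"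
    (is "_ \<longleftrightarrow> (\<forall>q. _ \<longrightarrow> poly q 0 = ?f q)")
proof -
  have lin: "poly_linear ?f"
    by (simp add: poly_linear_def pderiv_add pderiv_smult algebra_simps sum.distrib sum_subtractf
        sum_distrib_left)
  have f_monom: "?f (monom 1 m) = (\<Sum>j=1..k. real j ^ m * \<alpha> j - real m * real j ^ (m - 1) * \<beta> j)" for m
    by (simp add: poly_monom pderiv_monom algebra_simps)
  have order: "lm_order k \<alpha> \<beta> p \<longleftrightarrow> (\<forall>m\<le>p. poly (monom 1 m) 0 = ?f (monom 1 m))"
    unfolding f_monom unfolding poly_monom lm_order_def using assms
    by (auto simp: lm_explicit_def power_0_left Suc_le_eq dest: spec[of _ 0])
  show ?thesis unfolding order
  proof (intro iffI allI impI)
    fix q :: "real poly" assume *: "\<forall>m\<le>p. poly (monom 1 m) 0 = ?f (monom 1 m)" "degree q \<le> p"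
    have "poly q 0 = (\<Sum>m\<le>p. coeff q m * poly (monom 1 m) 0)"
      by (rule poly_linear_coeffs[OF poly_linear_poly *(2)])
    also have "\<dots> = (\<Sum>m\<le>p. coeff q m * ?f (monom 1 m))"
      using *(1) by (intro sum.cong) auto
    also have "\<dots> = ?f q" by (rule poly_linear_coeffs[OF lin *(2), symmetric])
    finally show "poly q 0 = ?f q" .
  next
    fix m assume *: "\<forall>q. degree q \<le> p \<longrightarrow> poly q 0 = ?f q" "m \<le> p"
    show "poly (monom 1 m) 0 = ?f (monom 1 m)"
      using *(1)[rule_format, of "monom 1 m"] *(2) by (simp add: degree_monom_eq)
  qed
qed

lemma C_exp_ge:
  assumes "represents (\<lambda>_. g) p k \<delta> \<beta> 0" "0 \<le> g"
  shows "ereal g \<le> C_exp k p"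
proof -
  define a where "a j = \<delta> j + g * \<beta> j" for j
  \<comment> \<open>\<open>represents\<close> does not constrain \<open>\<beta> 0\<close>; resetting
    it makes the method explicit.\<close>
  define b where "b = \<beta>(0 := 0)"
  have b: "b j = \<beta> j" if "j \<in> {1..k}" for j using that by (simp add: b_def)
  have nonneg: "0 \<le> \<delta> j" "0 \<le> \<beta> j" if "j \<in> {1..k}" for j
    using assms(1) that by (auto simp: represents_def)
  have expl: "lm_explicit b" by (simp add: lm_explicit_def b_def)
  have "(\<Sum>j=1..k. a j * poly q (real j) - b j * poly (pderiv q) (real j)) =
      (\<Sum>j=1..k. \<delta> j * poly q (real j) + \<beta> j * (g * poly q (real j) - poly (pderiv q) (real j)))" for q
    by (intro sum.cong) (auto simp: a_def b algebra_simps)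
  then have ord: "lm_order k a b p"
    using assms(1) unfolding lm_order_iff_poly[OF expl] represents_def by simp
  have "ereal g \<le> (INF j\<in>{j\<in>{1..k}. b j \<noteq> 0}. ereal (a j / b j))"
  proof (intro INF_greatest)
    fix j assume "j \<in> {j\<in>{1..k}. b j \<noteq> 0}"
    then have "j \<in> {1..k}" "\<beta> j \<noteq> 0" using b by auto
    then show "ereal g \<le> ereal (a j / b j)"
      using nonneg[of j] by (simp add: b a_def field_simps)
  qed
  moreover have "\<forall>j\<in>{1..k}. 0 \<le> a j" using nonneg assms(2) by (auto simp: a_def)
  moreover have "\<forall>j\<in>{0..k}. 0 \<le> b j" using nonneg by (auto simp: b_def)
  ultimately have "ereal g \<le> ssp_coeff k a b" by (simp add: ssp_coeff_def)
  also have "\<dots> \<le> C_exp k p"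
    using expl ord by (auto simp: C_exp_def Let_def intro!: Sup_upper)
  finally show ?thesis .
qed

text \<open>A method with coefficient above \<open>r\<close> becomes a representation by
  \<open>\<delta> j = \<alpha> j - r * \<beta> j\<close>.\<close>

lemma C_exp_le:
  assumes "0 \<le> g" "\<And>r \<delta> \<beta>. 0 < r \<Longrightarrow> represents (\<lambda>_. r) p k \<delta> \<beta> 0 \<Longrightarrow> r \<le> g"
  shows "C_exp k p \<le> ereal g"
proof -
  have "ssp_coeff k \<alpha> \<beta> \<le> ereal g" if expl: "lm_explicit \<beta>" and ord: "lm_order k \<alpha> \<beta> p" for \<alpha> \<beta>
  proof (rule ccontr)
    assume "\<not> ?thesis"
    \<comment> \<open>A real intermediate value also covers an infinite coefficient; being positive,
      it excludes the default value 0 and so forces nonnegative coefficients.\<close>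
    then obtain r where r: "g < r" "ereal r < ssp_coeff k \<alpha> \<beta>"
      by (metis ereal_dense2 not_le ereal_less_ereal_Ex less_ereal.simps(1))
    then have pos: "(\<forall>j\<in>{1..k}. 0 \<le> \<alpha> j) \<and> (\<forall>j\<in>{0..k}. 0 \<le> \<beta> j)"
      using assms(1) by (auto simp: ssp_coeff_def split: if_splits)
    have le: "r * \<beta> j \<le> \<alpha> j" if j: "j \<in> {1..k}" for j
    proof (cases "\<beta> j = 0")
      case False
      have "ereal r \<le> (INF j\<in>{j\<in>{1..k}. \<beta> j \<noteq> 0}. ereal (\<alpha> j / \<beta> j))"
        using r(2) pos by (simp add: ssp_coeff_def)
      also have "\<dots> \<le> ereal (\<alpha> j / \<beta> j)" using j False by (intro INF_lower) auto
      finally have "r \<le> \<alpha> j / \<beta> j" by simp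
      moreover have "0 \<le> \<beta> j" using pos j by auto
      then have "0 < \<beta> j" using False by simp
      ultimately show ?thesis by (simp add: field_simps)
    qed (use pos j in auto)
    have "represents (\<lambda>_. r) p k (\<lambda>j. \<alpha> j - r * \<beta> j) \<beta> 0"
      using ord pos le unfolding lm_order_iff_poly[OF expl] represents_def
      by (auto simp: algebra_simps intro!: sum.cong)
    then show False using assms r(1) by (meson le_less_trans not_le)
  qed
  then show ?thesis using assms(1)
    by (auto simp: C_exp_def Let_def intro!: Sup_least)
qed

text \<open>Weak duality: a representation with \<open>r > g\<close>, evaluated at \<open>t\<close>,
  would give \<open>t(0) \<ge> 0\<close>.\<close>

lemma C_exp_le_dual:
  assumes "0 \<le> g" "degree t \<le> p" "poly t 0 < 0"
    and t: "\<And>j. j \<in> {1..k} \<Longrightarrow> 0 \<le> poly t (real j)"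
      "\<And>j. j \<in> {1..k} \<Longrightarrow> poly (pderiv t) (real j) \<le> g * poly t (real j)"
  shows "C_exp k p \<le> ereal g"
proof (rule C_exp_le[OF assms(1)], rule ccontr)
  fix r \<delta> \<beta> assume rep: "represents (\<lambda>_. r) p k \<delta> \<beta> 0" and r: "\<not> r \<le> g"
  have "0 \<le> \<delta> j * poly t (real j) + \<beta> j * (r * poly t (real j) - poly (pderiv t) (real j))"
    if "j \<in> {1..k}" for j
  proof -
    have "g * poly t (real j) \<le> r * poly t (real j)" using r t(1)[OF that] by (intro mult_right_mono) auto
    then have "0 \<le> r * poly t (real j) - poly (pderiv t) (real j)" using t(2)[OF that] by simp
    then show ?thesis using rep that t(1)[OF that] by (simp add: represents_def)
  qed
  then have "0 \<le> (\<Sum>j=1..k. \<delta> j * poly t (real j) +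
      \<beta> j * (r * poly t (real j) - poly (pderiv t) (real j)))"
    by (rule sum_nonneg)
  also have "\<dots> = poly t 0" using rep assms(2) by (simp add: represents_def)
  finally show False using assms(3) by simp
qed

section \<open>The limit coefficient: monotonicity, positivity, and a representation attaining
  it\<close>

lemma C_exp_mono: "k \<le> l \<Longrightarrow> C_exp k p \<le> C_exp l p"
  by (rule incseqD[OF incseq_SucI[of "\<lambda>k. C_exp k p", OF C_exp_Suc]])

lemma C_exp_le_inf: "C_exp k p \<le> C_exp_inf p"
  by (rule incseq_le[OF incseq_SucI[of "\<lambda>k. C_exp k p", OF C_exp_Suc] C_exp_tendsto])

lemma C_exp_inf_le: "(\<And>k. C_exp k p \<le> x) \<Longrightarrow> C_exp_inf p \<le> x"
  by (rule LIMSEQ_le_const2[OF C_exp_tendsto]) blast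

text \<open>
  Letting \<open>\<gamma> j = 1 / j\<^sup>2\<close> depend on the node defeats every separating polynomial: nonconstant
  polynomials have \<open>u' / u\<close> of order \<open>1 / x\<close>. Finitely many nodes then share a positive \<open>\<gamma>\<close>.
\<close>

lemma C_exp_inf_pos: "0 < C_exp_inf p"
proof -
  define \<gamma> where "\<gamma> j = 1 / (real j)\<^sup>2" for j :: nat
  have "\<exists>k \<delta> \<beta> c. represents \<gamma> (Suc p) k \<delta> \<beta> c"
  proof (rule ccontr)
    assume "\<nexists>k \<delta> \<beta> c. represents \<gamma> (Suc p) k \<delta> \<beta> c"
    then obtain u where u: "u \<noteq> 0" "poly u 0 \<le> 0" "\<And>j. 1 \<le> j \<Longrightarrow> 0 \<le> poly u (real j)"
        "\<And>j. 1 \<le> j \<Longrightarrow> poly (pderiv u) (real j) \<le> \<gamma> j * poly u (real j)"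
      by (rule weak_dual) blast
    have lu: "0 < lead_coeff u"
      using lead_coeff_nonneg_if_nat[OF u(3)] u(1) by (simp add: le_less)
    have deg: "0 < degree u"
    proof (rule ccontr)
      assume "\<not> ?thesis"
      then have "poly u 0 = lead_coeff u" by (simp add: poly_0_coeff_0)
      then show False using lu u(2) by simp
    qed
    \<comment> \<open>The constraints multiplied by \<open>j^2\<close> say
      \<open>R(j) \<ge> 0\<close>, yet the leading term of \<open>R\<close> is that of
      \<open>- x^2 u'\<close>, which is negative.\<close>
    define R where "R = u - monom 1 2 * pderiv u"
    have "0 \<le> lead_coeff R"
    proof (rule lead_coeff_nonneg_if_nat)
      fix j :: nat assume "1 \<le> j"
      then show "0 \<le> poly R (real j)" using u(4)[of j]
        by (simp add: R_def poly_monom \<gamma>_def field_simps)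
    qed
    moreover have "coeff R (Suc (degree u)) = - (real (degree u) * lead_coeff u)"
      using deg by (simp add: R_def coeff_monom_mult coeff_eq_0 coeff_pderiv Suc_diff_le numeral_2_eq_2)
    moreover have "degree R \<le> Suc (degree u)"
      unfolding R_def using deg
      by (intro degree_diff_le) (auto intro!: order_trans[OF degree_mult_le] simp: degree_monom_eq degree_pderiv)
    ultimately show False using lu deg
      by (metis le_antisym le_degree mult_pos_pos neg_0_le_iff_le neg_equal_0_iff_equal not_le
          of_nat_0_less_iff order_less_irrefl)
  qed
  then obtain k \<delta> \<beta> where rep: "represents \<gamma> p k \<delta> \<beta> 0"
    using represents_lower_degree lessI by blast
  \<comment> \<open>A common lower bound of the \<open>\<gamma> j\<close>, positive also for
    \<open>k = 0\<close>; the excess \<open>\<gamma> j - g\<close> moves into the value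
    weights.\<close>
  define g where "g = 1 / (real k + 1)\<^sup>2"
  have g: "0 < g" by (simp add: g_def)
  have "g \<le> \<gamma> j" if "j \<in> {1..k}" for j
    using that by (auto simp: g_def \<gamma>_def intro!: divide_left_mono power_mono)
  then have "0 \<le> \<delta> j + \<beta> j * (\<gamma> j - g) \<and> 0 \<le> \<beta> j" if "j \<in> {1..k}" for j
    using rep that by (auto simp: represents_def)
  then have "represents (\<lambda>_. g) p k (\<lambda>j. \<delta> j + \<beta> j * (\<gamma> j - g)) \<beta> 0"
    using rep by (simp add: represents_def algebra_simps)
  then have "ereal g \<le> C_exp k p" using g by (intro C_exp_ge) auto
  also have "\<dots> \<le> C_exp_inf p" by (rule C_exp_le_inf)
  finally show ?thesis using g by (metis ereal_less(2) less_le_trans)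
qed

lemma C_exp_inf_real:
  assumes "1 \<le> p"
  obtains g where "C_exp_inf p = ereal g" "0 < g"
proof -
  have "C_exp_inf p \<le> 1" using C_exp_le_1[OF assms] by (rule C_exp_inf_le)
  then show thesis using C_exp_inf_pos[of p] that by (cases "C_exp_inf p") auto
qed

text \<open>Otherwise \<open>strict_dual\<close> yields a polynomial of degree at most
  \<open>p\<close> bounding all \<open>C_exp k p\<close> by some \<open>g' < g\<close>, which
  contradicts the limit.\<close>

lemma represents_C_exp_inf:
  assumes "odd p" "C_exp_inf p = ereal g" "0 < g"
  obtains k \<delta> \<beta> c where "represents (\<lambda>_. g) (Suc p) k \<delta> \<beta> c"
proof -
  have "\<exists>k \<delta> \<beta> c. represents (\<lambda>_. g) (Suc p) k \<delta> \<beta> c"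
  proof (rule ccontr)
    assume "\<nexists>k \<delta> \<beta> c. represents (\<lambda>_. g) (Suc p) k \<delta> \<beta> c"
    with assms(1,3) obtain t g' where t: "degree t \<le> p" "poly t 0 < 0" "0 < g'" "g' < g"
        "\<And>j. 1 \<le> j \<Longrightarrow> 0 \<le> poly t (real j)"
        "\<And>j. 1 \<le> j \<Longrightarrow> poly (pderiv t) (real j) \<le> g' * poly t (real j)"
      by (rule strict_dual) blast
    have "C_exp_inf p \<le> ereal g'"
      using t by (intro C_exp_inf_le C_exp_le_dual[of g' t]) auto
    then show False using assms(2) t(4) by simp
  qed
  then show thesis using that by blast
qed

section \<open>Trading one order against the coefficient\<close>

text \<open>Apply the representation to \<open>(k - x) q(x)\<close>.\<close>

lemma represents_drop_order:
  assumes "represents (\<lambda>_. r) (Suc m) k \<delta> \<beta> 0" "2 \<le> k"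
  obtains \<delta>' \<beta>' where "represents (\<lambda>_. r + 1 / (real k - 1)) m k \<delta>' \<beta>' 0"
proof
  \<comment> \<open>For \<open>Q = (k - x) q\<close> one has \<open>Q(0) = k q(0)\<close>, hence the
    division by \<open>k\<close>. Since \<open>Q' = (k - x) q' - q\<close>, each derivative term
    releases \<open>\<beta> j / k\<close> as value weight, which pays for the larger rate because
    \<open>k - j \<le> k - 1\<close>.\<close>
  define \<beta>' where "\<beta>' j = \<beta> j * (real k - real j) / real k" for j
  define \<delta>' where
    "\<delta>' j = \<delta> j * (real k - real j) / real k + \<beta> j / real k - \<beta>' j / (real k - 1)" for j
  have nonneg: "0 \<le> \<delta> j" "0 \<le> \<beta> j" if "j \<in> {1..k}" for j
    using assms(1) that by (auto simp: represents_def)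
  have k: "0 < real k" "0 < real k - 1" using assms(2) by auto
  have "0 \<le> \<delta>' j \<and> 0 \<le> \<beta>' j" if j: "j \<in> {1..k}" for j
  proof
    show "0 \<le> \<beta>' j" using nonneg j by (auto simp: \<beta>'_def)
    have "\<beta>' j / (real k - 1) = \<beta> j / real k * ((real k - real j) / (real k - 1))"
      by (simp add: \<beta>'_def)
    also have "\<dots> \<le> \<beta> j / real k * 1"
      using nonneg[OF j] j k by (intro mult_left_mono) auto
    finally have "\<beta>' j / (real k - 1) \<le> \<beta> j / real k" by simp
    moreover have "0 \<le> \<delta> j * (real k - real j) / real k" using nonneg[OF j] j by simp
    ultimately show "0 \<le> \<delta>' j" by (simp add: \<delta>'_def)
  qed
  moreover have "poly q 0 = (\<Sum>j=1..k. \<delta>' j * poly q (real j) +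
      \<beta>' j * ((r + 1 / (real k - 1)) * poly q (real j) - poly (pderiv q) (real j)))"
    if "degree q \<le> m" for q
  proof -
    define Q where "Q = [:real k, - 1:] * q"
    have "degree Q \<le> Suc m" unfolding Q_def using that by (intro order_trans[OF degree_mult_le]) simp
    moreover have Q: "poly Q x = (real k - x) * poly q x" for x by (simp add: Q_def algebra_simps)
    moreover have Q': "poly (pderiv Q) x = (real k - x) * poly (pderiv q) x - poly q x" for x
      unfolding Q_def pderiv_mult by (simp add: pderiv_pCons algebra_simps)
    moreover have "poly Q 0 = (\<Sum>j=1..k. \<delta> j * poly Q (real j) +
        \<beta> j * (r * poly Q (real j) - poly (pderiv Q) (real j)))"
      using assms(1) \<open>degree Q \<le> Suc m\<close> by (simp add: represents_def)
    ultimately have "real k * poly q 0 = (\<Sum>j=1..k. \<delta> j * poly Q (real j) +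
        \<beta> j * (r * poly Q (real j) - poly (pderiv Q) (real j)))"
      by simp
    then have "poly q 0 = (\<Sum>j=1..k. \<delta> j * poly Q (real j) +
        \<beta> j * (r * poly Q (real j) - poly (pderiv Q) (real j))) / real k"
      using k by (simp add: field_simps)
    also have "\<dots> = (\<Sum>j=1..k. \<delta>' j * poly q (real j) +
        \<beta>' j * ((r + 1 / (real k - 1)) * poly q (real j) - poly (pderiv q) (real j)))"
      unfolding sum_divide_distrib
    proof (intro sum.cong refl)
      fix j
      have "\<beta>' j / (real k - 1) * poly q (real j) = \<beta>' j * (1 / (real k - 1)) * poly q (real j)" by simp
      then show "(\<delta> j * poly Q (real j) + \<beta> j * (r * poly Q (real j) - poly (pderiv Q) (real j))) / real k =
          \<delta>' j * poly q (real j) +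
          \<beta>' j * ((r + 1 / (real k - 1)) * poly q (real j) - poly (pderiv q) (real j))"
        unfolding Q Q' \<delta>'_def using k(1)
        by (simp add: distrib_left distrib_right left_diff_distrib right_diff_distrib)
           (simp add: \<beta>'_def field_simps)
    qed
    finally show ?thesis .
  qed
  ultimately show "represents (\<lambda>_. r + 1 / (real k - 1)) m k \<delta>' \<beta>' 0"
    by (simp add: represents_def)
qed

text \<open>
  Conversely, \<open>q = q(k) + (x - k) r(x)\<close> and the representation for \<open>r\<close> give one for \<open>q\<close> with the
  additional node \<open>k\<close>. Its weight \<open>w\<close> is determined by \<open>q = x^n\<close>, so \<open>w k^n\<close> tends to \<open>c\<close>.
\<close>

lemma represents_raise_order:
  assumes rep: "represents (\<lambda>_. g) (Suc m) K \<delta> \<beta> c" and c: "0 < c"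
  shows "\<forall>\<^sub>F k in sequentially.
    \<exists>\<delta>' \<beta>'. represents (\<lambda>_. g - 1 / (real k - real K)) (Suc m) k \<delta>' \<beta>' 0"
proof -
  define n where "n = Suc m"
  have nonneg: "0 \<le> \<delta> j" "0 \<le> \<beta> j" if "j \<in> {1..K}" for j
    using rep that by (auto simp: represents_def)
  \<comment> \<open>From \<open>q = z + (x - k) r\<close>,
    \<open>- k * r(j) = \<phi> k j * (q(j) - z)\<close>. Differentiating the quotient costs
    \<open>1 / (k - j)\<close> in the rate, so \<open>F k\<close> expresses
    \<open>- k * r(0)\<close> through \<open>q - z\<close>.\<close>
  define \<phi> where "\<phi> k j = real k / (real k - real j)" for k j :: nat
  define F where "F k q = (\<Sum>j=1..K. \<delta> j * (\<phi> k j * poly q (real j)) +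
      \<beta> j * (\<phi> k j * ((g - 1 / (real k - real j)) * poly q (real j) - poly (pderiv q) (real j))))"
    for k :: nat and q
  \<comment> \<open>Exactness on constants fixes the weight of node \<open>k\<close>; its sign is
    read off later from \<open>x^n\<close>.\<close>
  define w where "w k = 1 - F k 1" for k
  have id: "poly q 0 = F k q + w k * poly q (real k)" if k: "K < k" and q: "degree q \<le> n" for k q
  proof -
    define r where "r = synthetic_div q (real k)"
    define z where "z = poly q (real k)"
    have q_eq: "q = [:- real k, 1:] * r + [:z:]"
      using synthetic_div_correct'[of "real k" q] by (simp add: r_def z_def)
    have qx: "poly q x = (x - real k) * poly r x + z" for x
      by (rule trans[OF arg_cong[OF q_eq, of "\<lambda>q. poly q x"]]) (simp add: algebra_simps)
    have q'x: "poly (pderiv q) x = poly r x + (x - real k) * poly (pderiv r) x" for x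
      by (rule trans[OF arg_cong[OF q_eq, of "\<lambda>q. poly (pderiv q) x"]],
          unfold pderiv_add pderiv_mult) (simp add: pderiv_pCons algebra_simps)
    \<comment> \<open>The quotient loses one degree, so the node at infinity does not
      contribute.\<close>
    have "degree r \<le> m" using q by (simp add: r_def degree_synthetic_div n_def)
    then have r0: "poly r 0 = (\<Sum>j=1..K. \<delta> j * poly r (real j) +
        \<beta> j * (g * poly r (real j) - poly (pderiv r) (real j)))"
      using rep by (simp add: represents_def coeff_eq_0)
    have "F k q = z * F k 1 - real k * poly r 0"
      unfolding F_def r0 sum_distrib_left sum_subtractf[symmetric]
    proof (intro sum.cong refl)
      fix j assume "j \<in> {1..K}"
      then have d: "real k - real j \<noteq> 0" using k by auto
      define d where "d = real k - real j"
      have j: "real j = real k - d" "d \<noteq> 0" using d by (auto simp: d_def)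
      show "\<delta> j * (\<phi> k j * poly q (real j)) + \<beta> j * (\<phi> k j *
            ((g - 1 / (real k - real j)) * poly q (real j) - poly (pderiv q) (real j))) =
          z * (\<delta> j * (\<phi> k j * poly 1 (real j)) + \<beta> j * (\<phi> k j *
            ((g - 1 / (real k - real j)) * poly 1 (real j) - poly (pderiv 1) (real j)))) -
          real k * (\<delta> j * poly r (real j) + \<beta> j * (g * poly r (real j) - poly (pderiv r) (real j)))"
        unfolding qx q'x \<phi>_def d_def[symmetric] using j(2)
        by (simp add: d_def[symmetric] j(1) field_simps)
    qed
    moreover have "poly q 0 = z - real k * poly r 0" by (simp add: qx)
    ultimately show ?thesis by (simp add: w_def z_def algebra_simps)
  qed
  \<comment> \<open>The losses \<open>1 / (k - j)\<close> are replaced by the largest one, at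
    \<open>j = K\<close>; the differences go into the value weights.\<close>
  have rep': "represents (\<lambda>_. g - 1 / (real k - real K)) n k
      (\<lambda>j. if j \<le> K then \<delta> j * \<phi> k j + \<beta> j * (\<phi> k j * (1 / (real k - real K) - 1 / (real k - real j)))
           else if j = k then w k else 0)
      (\<lambda>j. if j \<le> K then \<beta> j * \<phi> k j else 0) 0" (is "represents _ _ _ ?\<delta> ?\<beta> _")
    if k: "K < k" and w: "0 \<le> w k" for k
  proof -
    have "0 \<le> ?\<delta> j \<and> 0 \<le> ?\<beta> j" if "j \<in> {1..k}" for j
    proof (cases "j \<le> K")
      case True
      then have "0 \<le> \<phi> k j" using k by (simp add: \<phi>_def)
      moreover have "1 / (real k - real j) \<le> 1 / (real k - real K)"
        using True k by (intro divide_left_mono) auto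
      ultimately show ?thesis using True nonneg[of j] that by simp
    qed (use w in auto)
    moreover have "poly q 0 = (\<Sum>j=1..k. ?\<delta> j * poly q (real j) +
        ?\<beta> j * ((g - 1 / (real k - real K)) * poly q (real j) - poly (pderiv q) (real j)))"
      (is "_ = sum ?h _") if q: "degree q \<le> n" for q
    proof -
      have "sum ?h {1..k} = sum ?h (insert k {1..K})"
        using k by (intro sum.mono_neutral_right) auto
      also have "\<dots> = w k * poly q (real k) + sum ?h {1..K}" using k by simp
      also have "sum ?h {1..K} = F k q"
        unfolding F_def by (intro sum.cong) (auto simp: algebra_simps)
      finally show ?thesis using id[OF k q] by simp
    qed
    ultimately show ?thesis by (simp add: represents_def)
  qed
  have \<phi>: "(\<lambda>k. \<phi> k j) \<longlonglongrightarrow> 1" and inv: "(\<lambda>k. 1 / (real k - real j)) \<longlonglongrightarrow> 0" for j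
    unfolding \<phi>_def by real_asymp+
  \<comment> \<open>The limit is the finite part of the given representation at \<open>x^n\<close>,
    hence \<open>- c\<close>. As \<open>x^n\<close> vanishes at 0, \<open>w k * k^n\<close> must
    compensate and is eventually positive.\<close>
  have "(\<lambda>k. F k (monom 1 n)) \<longlonglongrightarrow> (\<Sum>j=1..K. \<delta> j * (1 * poly (monom 1 n) (real j)) +
      \<beta> j * (1 * ((g - 0) * poly (monom 1 n) (real j) - poly (pderiv (monom 1 n)) (real j))))"
    unfolding F_def by (intro tendsto_intros \<phi> inv)
  also have "(\<Sum>j=1..K. \<delta> j * (1 * poly (monom 1 n) (real j)) +
      \<beta> j * (1 * ((g - 0) * poly (monom 1 n) (real j) - poly (pderiv (monom 1 n)) (real j)))) = - c"
    using rep[unfolded represents_def, THEN conjunct2, THEN conjunct2, rule_format, of "monom 1 n"]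
    by (simp add: degree_monom_eq n_def poly_monom)
  finally have "\<forall>\<^sub>F k in sequentially. F k (monom 1 n) < 0"
    using c by (intro order_tendstoD) auto
  then have "\<forall>\<^sub>F k in sequentially. F k (monom 1 n) < 0 \<and> K < k"
    using eventually_gt_at_top by (intro eventually_conj) auto
  then show ?thesis
  proof (rule eventually_mono)
    fix k assume k: "F k (monom 1 n) < 0 \<and> K < k"
    then have "0 = F k (monom 1 n) + w k * real k ^ n"
      using id[of k "monom 1 n"] by (simp add: degree_monom_eq poly_monom n_def)
    then have "0 < w k * real k ^ n" using k by simp
    then have "0 \<le> w k" by (simp add: zero_less_mult_iff split: if_splits)
    then show "\<exists>\<delta>' \<beta>'. represents (\<lambda>_. g - 1 / (real k - real K)) (Suc m) k \<delta>' \<beta>' 0"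
      using rep' k unfolding n_def by blast
  qed
qed

section \<open>Eventual constancy for odd order and two-sided bounds for even order\<close>

lemma C_exp_eventually_const:
  assumes "odd p"
  obtains K where "\<And>k. K \<le> k \<Longrightarrow> C_exp k p = C_exp_inf p"
proof -
  have "1 \<le> p" using assms by (cases p) auto
  then obtain g where g: "C_exp_inf p = ereal g" "0 < g" by (rule C_exp_inf_real)
  obtain K \<delta> \<beta> c where "represents (\<lambda>_. g) (Suc p) K \<delta> \<beta> c"
    using represents_C_exp_inf[OF assms g] .
  then have "represents (\<lambda>_. g) p K \<delta> \<beta> 0" by (rule represents_lower_degree) simp
  then have "C_exp_inf p \<le> C_exp K p" using C_exp_ge g by simp
  then show thesis using that C_exp_mono C_exp_le_inf by (metis antisym order_trans)
qed

text \<open>Giving up one order gains \<open>1 / (k - 1)\<close>, and the gained coefficient cannot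
  exceed the limit for order \<open>m\<close>.\<close>

lemma C_exp_Suc_upper:
  assumes "C_exp_inf m = ereal g" "2 \<le> k" "1 / (real k - 1) \<le> g"
  shows "C_exp k (Suc m) \<le> ereal (g - 1 / (real k - 1))"
proof (rule C_exp_le)
  show "0 \<le> g - 1 / (real k - 1)" using assms(3) by simp
next
  fix r \<delta> \<beta> assume r: "0 < r" "represents (\<lambda>_. r) (Suc m) k \<delta> \<beta> 0"
  obtain \<delta>' \<beta>' where "represents (\<lambda>_. r + 1 / (real k - 1)) m k \<delta>' \<beta>' 0"
    using represents_drop_order[OF r(2) assms(2)] .
  then have "ereal (r + 1 / (real k - 1)) \<le> C_exp k m"
    using r(1) assms(2) by (intro C_exp_ge) auto
  also have "\<dots> \<le> ereal g" using C_exp_le_inf[of k m] assms(1) by simp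
  finally show "r \<le> g - 1 / (real k - 1)" by simp
qed

lemma C_exp_Suc_lower:
  assumes "odd m" "C_exp_inf m = ereal g" "0 < g"
  obtains K where "\<And>k. K < k \<Longrightarrow> ereal (g - 1 / (real k - real K)) \<le> C_exp k (Suc m)"
proof -
  obtain K \<delta> \<beta> c where rep: "represents (\<lambda>_. g) (Suc m) K \<delta> \<beta> c"
    using represents_C_exp_inf[OF assms] .
  have "\<exists>N. \<forall>k\<ge>N. K < k \<longrightarrow> ereal (g - 1 / (real k - real K)) \<le> C_exp k (Suc m)"
  \<comment> \<open>For \<open>c = 0\<close> the representation is already a method of order
    \<open>Suc m\<close> with rate \<open>g\<close>; otherwise a distant node replaces the node at
    infinity.\<close>
  proof (cases "c = 0")
    case True
    then have "ereal g \<le> C_exp K (Suc m)" using C_exp_ge[of g "Suc m" K \<delta> \<beta>] rep assms(3) by simp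
    then have ge: "ereal g \<le> C_exp k (Suc m)" if "K < k" for k
      using that C_exp_mono[of K k "Suc m"] by simp
    have "ereal (g - 1 / (real k - real K)) \<le> C_exp k (Suc m)" if "K < k" for k
    proof -
      have "ereal (g - 1 / (real k - real K)) \<le> ereal g" using that by simp
      also have "\<dots> \<le> C_exp k (Suc m)" using ge[OF that] .
      finally show ?thesis .
    qed
    then show ?thesis by blast
  next
    case False
    then have "0 < c" using rep by (auto simp: represents_def)
    from represents_raise_order[OF rep this]
    obtain N where N: "\<And>k. N \<le> k \<Longrightarrow>
        \<exists>\<delta>' \<beta>'. represents (\<lambda>_. g - 1 / (real k - real K)) (Suc m) k \<delta>' \<beta>' 0"
      by (auto simp: eventually_sequentially)
    have "ereal (g - 1 / (real k - real K)) \<le> C_exp k (Suc m)" if "N \<le> k" for k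
    proof (cases "0 \<le> g - 1 / (real k - real K)")
      case True
      then show ?thesis using N[OF that] C_exp_ge by blast
    next
      case False
      then have "ereal (g - 1 / (real k - real K)) \<le> 0" by simp
      then show ?thesis using C_exp_nonneg order_trans by blast
    qed
    then show ?thesis by blast
  qed
  then obtain N where N: "\<And>k. N \<le> k \<Longrightarrow> K < k \<Longrightarrow>
      ereal (g - 1 / (real k - real K)) \<le> C_exp k (Suc m)" by blast
  show thesis
  \<comment> \<open>Enlarging the shift weakens the bound, so one number serves as threshold and as
    shift.\<close>
  proof (rule that[of "max N K"])
    fix k assume k: "max N K < k"
    then have "1 / (real k - real K) \<le> 1 / (real k - real (max N K))"
      by (intro divide_left_mono) auto
    then have "ereal (g - 1 / (real k - real (max N K))) \<le> ereal (g - 1 / (real k - real K))" by simp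
    also have "\<dots> \<le> C_exp k (Suc m)" using N k by simp
    finally show "ereal (g - 1 / (real k - real (max N K))) \<le> C_exp k (Suc m)" .
  qed
qed

theorem theorem6p1:
  fixes p :: nat
  assumes "p \<ge> 1"
  shows "(odd p \<longrightarrow>
            (\<exists>K\<^sub>p::nat. K\<^sub>p \<ge> 1 \<and> (\<forall>k\<ge>K\<^sub>p. C_exp k p = C_exp_inf p))) \<and>
         (even p \<longrightarrow>
            (\<exists>k\<^sub>p::nat. k\<^sub>p \<ge> 1 \<and>
               (\<forall>k>k\<^sub>p.
                  ereal (1 / (real k - 1)) \<le> C_exp_inf (p - 1) - C_exp k p \<and>
                  C_exp_inf (p - 1) - C_exp k p \<le> ereal (1 / (real k - real k\<^sub>p)))))"
proof (intro conjI impI)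
  assume "odd p"
  then obtain K where K: "\<And>k. K \<le> k \<Longrightarrow> C_exp k p = C_exp_inf p"
    by (rule C_exp_eventually_const) blast
  then show "\<exists>K\<^sub>p::nat. K\<^sub>p \<ge> 1 \<and> (\<forall>k\<ge>K\<^sub>p. C_exp k p = C_exp_inf p)"
    by (intro exI[of _ "Suc K"]) auto
next
  assume "even p"
  then obtain m where m: "p = Suc m" "odd m" using assms by (cases p) auto
  then have "1 \<le> m" by (cases m) auto
  then obtain g where g: "C_exp_inf m = ereal g" "0 < g" by (rule C_exp_inf_real)
  obtain K where K: "\<And>k. K < k \<Longrightarrow> ereal (g - 1 / (real k - real K)) \<le> C_exp k p"
    using C_exp_Suc_lower[OF m(2) g] m(1) by blast
  \<comment> \<open>Ensures \<open>1 / (k - 1) \<le> g\<close> for \<open>k > N\<close>, so that the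
    upper bound for \<open>C_exp k p\<close> is nonnegative.\<close>
  obtain N :: nat where N: "1 / g + 1 \<le> real N" using real_arch_simple by blast
  define L where "L = Suc (max K N)"
  show "\<exists>k\<^sub>p::nat. k\<^sub>p \<ge> 1 \<and> (\<forall>k>k\<^sub>p.
      ereal (1 / (real k - 1)) \<le> C_exp_inf (p - 1) - C_exp k p \<and>
      C_exp_inf (p - 1) - C_exp k p \<le> ereal (1 / (real k - real k\<^sub>p)))"
  proof (intro exI[of _ L] conjI allI impI)
    show "1 \<le> L" by (simp add: L_def)
  next
    fix k assume k: "L < k"
    obtain x where x: "C_exp k p = ereal x"
      using C_exp_le_1[OF assms, of k] C_exp_nonneg[of k p] by (cases "C_exp k p") auto
    have "1 / g \<le> real k - 1" using N k by (simp add: L_def)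
    then have "1 / (real k - 1) \<le> g"
      using g(2) k by (simp add: L_def field_simps)
    then have "x \<le> g - 1 / (real k - 1)"
      using C_exp_Suc_upper[OF g(1), of k] k m(1) x by (simp add: L_def)
    then show "ereal (1 / (real k - 1)) \<le> C_exp_inf (p - 1) - C_exp k p"
      using g(1) m(1) x by simp
    have "g - 1 / (real k - real K) \<le> x" using K[of k] k x by (simp add: L_def)
    moreover have "1 / (real k - real K) \<le> 1 / (real k - real L)"
      using k by (intro divide_left_mono) (auto simp: L_def)
    ultimately show "C_exp_inf (p - 1) - C_exp k p \<le> ereal (1 / (real k - real L))"
      using g(1) m(1) x by simp
  qed
qed

end
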